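(* Let $R$ be a commutative ring with nonzero identity, $M$ an $R$-module, and $N\leq M$ a submodule. If $N$ is $u$-$\mathfrak{m}$-essential in $M$ for every maximal ideal $\mathfrak{m}$ of $R$, then $N$ is essential in $M$.
   Context: All modules are unitary. For a multiplicative subset $S$ of $R$ (that is, $1\in S$, $0\notin S$, $S$ closed under products), an $R$-module $X$ is $u$-$S$-torsion if there exists $s\in S$ with $sX=0$, and a submodule $N$ of $M$ is $u$-$S$-essential in $M$ if for every submodule $L$ of $M$, $N\cap L$ being $u$-$S$-torsion implies that $L$ is $u$-$S$-torsion. For a prime ideal $\mathfrak{p}$ of $R$, $N$ is $u$-$\mathfrak{p}$-essential in $M$ if $N$ is $u$-$(R\setminus\mathfrak{p})$-essential in $M$. A submodule $N$ of $M$ is essential in $M$ if for every submodule $L$ of $M$, $N\cap L=0$ implies $L=0$. *)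

theory Defs
  imports "HOL-Algebra.Module" "HOL-Algebra.Ideal"
begin

definition multiplicative_subset :: "('a, 'c) ring_scheme \<Rightarrow> 'a set \<Rightarrow> bool" where
  "multiplicative_subset R S \<longleftrightarrow> submonoid S R \<and> \<zero>\<^bsub>R\<^esub> \<notin> S"

definition u_S_torsion :: "'a set \<Rightarrow> ('a, 'b, 'd) module_scheme \<Rightarrow> bool" where
  "u_S_torsion S X \<longleftrightarrow> (\<exists>s\<in>S. \<forall>x\<in>carrier X. s \<odot>\<^bsub>X\<^esub> x = \<zero>\<^bsub>X\<^esub>)"

text \<open>
  A submodule \<open>H\<close> of \<open>M\<close>, regarded as a module in its own right, is \<open>M\<lparr>carrier := H\<rparr>\<close>.
  The next definition is meant for multiplicative subsets \<open>S\<close> of \<open>R\<close>; the lemmas below show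
  that the complements of prime, hence of maximal, ideals are such.
\<close>

definition u_S_essential ::
  "('a, 'c) ring_scheme \<Rightarrow> 'a set \<Rightarrow> ('a, 'b, 'd) module_scheme \<Rightarrow> 'b set \<Rightarrow> bool" where
  "u_S_essential R S M N \<longleftrightarrow>
    (\<forall>L. submodule L R M \<longrightarrow>
      u_S_torsion S (M\<lparr>carrier := N \<inter> L\<rparr>) \<longrightarrow> u_S_torsion S (M\<lparr>carrier := L\<rparr>))"

definition u_prime_essential ::
  "('a, 'c) ring_scheme \<Rightarrow> 'a set \<Rightarrow> ('a, 'b, 'd) module_scheme \<Rightarrow> 'b set \<Rightarrow> bool" where
  "u_prime_essential R P M N \<longleftrightarrow> u_S_essential R (carrier R - P) M N"

definition essential ::
  "('a, 'c) ring_scheme \<Rightarrow> ('a, 'b, 'd) module_scheme \<Rightarrow> 'b set \<Rightarrow> bool" where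
  "essential R M N \<longleftrightarrow>
    (\<forall>L. submodule L R M \<longrightarrow> N \<inter> L = {\<zero>\<^bsub>M\<^esub>} \<longrightarrow> L = {\<zero>\<^bsub>M\<^esub>})"

lemma primeideal_complement_multiplicative:
  assumes "primeideal P R"
  shows "multiplicative_subset R (carrier R - P)"
proof -
  interpret primeideal P R by fact
  have "\<one>\<^bsub>R\<^esub> \<notin> P"
    using I_notcarr one_imp_carrier by blast
  then show ?thesis
    unfolding multiplicative_subset_def
    by (intro conjI submonoid.intro) (auto dest: I_prime)
qed

lemma maximalideal_complement_multiplicative:
  assumes "cring R" "maximalideal P R"
  shows "multiplicative_subset R (carrier R - P)"
  using assms cring.maximalideal_prime primeideal_complement_multiplicative by blast

end

theory Submission
  imports "HOL-Algebra.Ring_Divisibility" Defs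
begin

text \<open>
  Let \<open>L\<close> be a submodule with \<open>N \<inter> L = 0\<close>. The hypothesis at a maximal ideal \<open>P\<close> yields an element
  outside \<open>P\<close> that annihilates \<open>L\<close>. Hence the annihilator of \<open>L\<close> lies in no maximal ideal, so it
  contains \<open>\<one>\<close> by Krull's theorem, and \<open>L = 0\<close>.
\<close>

definition annihilator ::
  "('a, 'c) ring_scheme \<Rightarrow> ('a, 'b, 'd) module_scheme \<Rightarrow> 'b set \<Rightarrow> 'a set" where
  "annihilator R M L = {r \<in> carrier R. \<forall>x\<in>L. r \<odot>\<^bsub>M\<^esub> x = \<zero>\<^bsub>M\<^esub>}"

lemma (in module) annihilator_ideal:
  assumes "L \<subseteq> carrier M"
  shows "ideal (annihilator R M L) R"
proof (rule idealI)
  show "ring R"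
    by (rule R.ring_axioms)
  show "subgroup (annihilator R M L) (add_monoid R)"
  proof (rule R.add.subgroupI)
    show "annihilator R M L \<subseteq> carrier R"
      by (auto simp: annihilator_def)
    have "\<zero>\<^bsub>R\<^esub> \<in> annihilator R M L"
      using assms by (auto simp: annihilator_def)
    then show "annihilator R M L \<noteq> {}"
      by blast
    show "\<ominus>\<^bsub>R\<^esub> a \<in> annihilator R M L" if "a \<in> annihilator R M L" for a
      using that assms by (auto simp: annihilator_def smult_l_minus subset_iff)
    show "a \<oplus>\<^bsub>R\<^esub> b \<in> annihilator R M L"
      if "a \<in> annihilator R M L" "b \<in> annihilator R M L" for a b
      using that assms by (auto simp: annihilator_def smult_l_distr subset_iff)
  qed
  show l: "x \<otimes>\<^bsub>R\<^esub> a \<in> annihilator R M L"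
    if "a \<in> annihilator R M L" "x \<in> carrier R" for a x
    using that assms by (auto simp: annihilator_def smult_assoc1 subset_iff)
  show "a \<otimes>\<^bsub>R\<^esub> x \<in> annihilator R M L"
    if "a \<in> annihilator R M L" "x \<in> carrier R" for a x
    using l[OF that] that by (auto simp: annihilator_def R.m_comm)
qed

text \<open>Zorn's lemma applies to the ideals above \<open>I\<close> that avoid
  \<open>\<one>\<close>: properness of an ideal is the single condition
  \<open>\<one> \<notin> J\<close>, which passes to unions of chains.\<close>

lemma (in ring) proper_ideal_subset_maximalideal:
  assumes "ideal I R" "\<one> \<notin> I"
  obtains P where "maximalideal P R" "I \<subseteq> P"
proof -
  define A where "A = {J. ideal J R \<and> I \<subseteq> J \<and> \<one> \<notin> J}"
  have "\<exists>P\<in>A. \<forall>J\<in>A. P \<subseteq> J \<longrightarrow> J = P"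
  proof (rule subset_Zorn_nonempty)
    show "A \<noteq> {}"
      using assms by (auto simp: A_def)
    fix C assume C: "C \<noteq> {}" "subset.chain A C"
    then have "subset.chain {J. ideal J R} C"
      by (auto simp: subset.chain_def A_def)
    \<comment> \<open>Nonemptiness of \<open>C\<close> matters here, since the empty union is not an
      ideal.\<close>
    then have "ideal (\<Union>C) R"
      using chain_Union_is_ideal[of C] C(1) by simp
    then show "\<Union>C \<in> A"
      using C by (auto simp: subset.chain_def A_def)
  qed
  then obtain P where P: "P \<in> A" and max: "\<And>J. J \<in> A \<Longrightarrow> P \<subseteq> J \<Longrightarrow> J = P"
    by blast
  have "maximalideal P R"
  proof (rule maximalidealI)
    show "ideal P R" and "carrier R \<noteq> P"
      using P by (auto simp: A_def)
    \<comment> \<open>If \<open>\<one> \<notin> J\<close>, then \<open>J\<close> is in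
      \<open>A\<close> and maximality gives \<open>J = P\<close>; otherwise \<open>J\<close> is the
      whole ring.\<close>
    show "J = P \<or> J = carrier R" if J: "ideal J R" "P \<subseteq> J" "J \<subseteq> carrier R" for J
      using that P max[of J] ideal.one_imp_carrier[OF J(1)] by (auto simp: A_def)
  qed
  then show thesis
    using that P by (auto simp: A_def)
qed

theorem proposition2p14:
  fixes R :: "('a, 'c) ring_scheme"
    and M :: "('a, 'b, 'd) module_scheme"
    and N :: "'b set"
  assumes "cring R"
    and "\<one>\<^bsub>R\<^esub> \<noteq> \<zero>\<^bsub>R\<^esub>"
    and "module R M"
    and "submodule N R M"
    and "\<And>P. maximalideal P R \<Longrightarrow> u_prime_essential R P M N"
  shows "essential R M N"
  unfolding essential_def
proof (intro allI impI)
  interpret module R M by fact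
  fix L assume L: "submodule L R M" and NL: "N \<inter> L = {\<zero>\<^bsub>M\<^esub>}"
  have sub: "L \<subseteq> carrier M"
    using submoduleE(1)[OF L] .
  have "\<one>\<^bsub>R\<^esub> \<in> annihilator R M L"
  proof (rule ccontr)
    assume "\<one>\<^bsub>R\<^esub> \<notin> annihilator R M L"
    then obtain P where P: "maximalideal P R" "annihilator R M L \<subseteq> P"
      using R.proper_ideal_subset_maximalideal annihilator_ideal[OF sub] by blast
    have "\<one>\<^bsub>R\<^esub> \<in> carrier R - P"
      using maximalideal_complement_multiplicative[OF assms(1) P(1)]
      by (auto simp: multiplicative_subset_def dest: submonoid.one_closed)
    \<comment> \<open>The zero module is killed by any scalar; \<open>\<one>\<close> serves as the
      witness outside \<open>P\<close>.\<close>
    then have "u_S_torsion (carrier R - P) (M\<lparr>carrier := N \<inter> L\<rparr>)"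
      by (auto simp: u_S_torsion_def NL intro!: bexI[of _ "\<one>\<^bsub>R\<^esub>"])
    then have "u_S_torsion (carrier R - P) (M\<lparr>carrier := L\<rparr>)"
      using assms(5)[OF P(1)] L by (simp add: u_prime_essential_def u_S_essential_def)
    \<comment> \<open>Uniformity of the torsion is what counts: one and the same \<open>s\<close>
      kills all of \<open>L\<close>, so it lies in the annihilator.\<close>
    then obtain s where "s \<in> carrier R - P" "s \<in> annihilator R M L"
      by (auto simp: u_S_torsion_def annihilator_def)
    then show False
      using P(2) by blast
  qed
  \<comment> \<open>For \<open>x\<close> in \<open>L\<close>, unitarity of \<open>M\<close> makes
    \<open>x\<close> equal to its product with \<open>\<one>\<close>, which is zero.\<close>
  then have "x = \<zero>\<^bsub>M\<^esub>" if "x \<in> L" for x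
    using that sub by (auto simp: annihilator_def subset_iff)
  then show "L = {\<zero>\<^bsub>M\<^esub>}"
    using NL by blast
qed

end
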